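(* Consider any instance of the congestion game in which every resource uses the Rand policy and in which the Smith ratios are uniform on every resource: for every $e\in E$ there is a real $\lambda_e\ge 0$ such that $p_{ej}\in\{\lambda_ew_j,\infty\}$ for every $j\in N$. Let $x$ be any (mixed) Nash equilibrium. Then there exists a feasible solution of (SDP-SR) with objective value at least $\frac12\,C(x)$, where $C$ is the social cost under Rand. This implies that the coordination ratio is at most $2$, i.e. $C(x)\le 2\,C^{SR}(x^* )$ for every Nash equilibrium $x$ and every pure assignment $x^*$, where $C^{SR}$ is the social cost under Smith's Rule.
   Context: Congestion model. $N$ is a finite set of players and $E$ a finite set of resources. Each player $j\in N$ has a weight $w_j>0$, a nonempty strategy set $\mathcal S_j\subseteq 2^E$, and processing times $p_{ej}\in[0,\infty]$ $(e\in E)$, with $p_{ej}<\infty$ whenever $e$ belongs to some strategy $i\in\mathcal S_j$. The Smith ratio is $\delta_{ej}=p_{ej}/w_j$. For each $e\in E$, $\prec_e$ is a strict total order on $N$ such that $k\prec_e j$ implies $\delta_{ek}\le\delta_{ej}$ (ties broken consistently). An assignment is $x=(x_{ij})_{j\in N,i\in\mathcal S_j}$ with $x_{ij}\ge 0$ and $\sum_{i\in\mathcal S_j}x_{ij}=1$ for all $j$ ($x_{ij}$ is the probability that $j$ independently chooses $i$); it is pure if all $x_{ij}\in\{0,1\}$. Put $z_{ej}=\sum_{i\in\mathcal S_j:\,e\in i}x_{ij}$. Terms containing a factor $z_{ek}=0$ are read as $0$. Rand. Each resource orders its players randomly so that $j$ comes after $k$ with probability $\delta_{ej}/(\delta_{ej}+\delta_{ek})$.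 The (expected) cost of player $j$ is $$C_j(x)=\sum_{i\in\mathcal S_j}x_{ij}\sum_{e\in i}\Big(p_{ej}+\sum_{k\ne j}\frac{\delta_{ej}}{\delta_{ej}+\delta_{ek}}\,p_{ek}z_{ek}\Big)$$ (a summand with $\delta_{ej}=\delta_{ek}=0$ is $0$, since then $p_{ek}=0$), and the social cost is $C(x)=\sum_{j\in N}w_jC_j(x)$. Nash equilibrium. $x$ is a (mixed) Nash equilibrium if $C_j(x)\le C_j(x_{-j},i)$ for all $j\in N$, $i\in\mathcal S_j$, where $(x_{-j},i)$ is obtained from $x$ by letting $j$ choose $i$ with probability $1$. Smith's Rule social cost: $C^{SR}(x)=\sum_{j\in N}w_j\sum_{i\in\mathcal S_j}x_{ij}\sum_{e\in i}\big(p_{ej}+\sum_{k\prec_e j}p_{ek}z_{ek}\big)$. The coordination ratio is the worst ratio between $C(x)$ for a Nash equilibrium $x$ (under the given policy) and the minimum of $C^{SR}$ over pure assignments. (SDP-SR): the variables are reals $y_j$ $(j\in N)$ and vectors $v_0, v_{ij}\in\mathbb R^d$ $(j\in N,i\in\mathcal S_j)$ for some $d\in\mathbb N$, with the standard inner product. Maximize $\sum_{j\in N}y_j-\frac12\|v_0\|^2$ subject to $y_j\le\sum_{e\in i}w_jp_{ej}-\frac12\|v_{ij}\|^2+\langle v_0,v_{ij}\rangle$ for all $j\in N,i\in\mathcal S_j$; and $\langle v_{ij},v_{i'k}\rangle\le\sum_{e\in i\cap i'}w_jw_k\min\{\delta_{ej},\delta_{ek}\}$ for all $(i,j)\ne(i',k)$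 with $j,k\in N$, $i\in\mathcal S_j$, $i'\in\mathcal S_k$. *)

theory Defs
  imports
    Complex_Main
    "HOL-Library.Extended_Nonnegative_Real"
    "Jordan_Normal_Form.Matrix"
begin

(* A pair (k, j) in prec G e means that player k precedes player j on resource e. *)
record ('j, 'e) game =
  players :: "'j set"
  resources :: "'e set"
  weight :: "'j \<Rightarrow> real"
  strategies :: "'j \<Rightarrow> 'e set set"
  ptime :: "'e \<Rightarrow> 'j \<Rightarrow> ennreal"
  prec :: "'e \<Rightarrow> ('j \<times> 'j) set"

definition smith_ratio :: "('j, 'e) game \<Rightarrow> 'e \<Rightarrow> 'j \<Rightarrow> ennreal" where
  "smith_ratio G e j = ptime G e j / ennreal (weight G j)"

definition congestion_game :: "('j, 'e) game \<Rightarrow> bool" where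
  "congestion_game G \<longleftrightarrow>
     finite (players G) \<and> finite (resources G) \<and>
     (\<forall>j\<in>players G. weight G j > 0 \<and> strategies G j \<noteq> {} \<and> strategies G j \<subseteq> Pow (resources G)) \<and>
     (\<forall>j\<in>players G. \<forall>i\<in>strategies G j. \<forall>e\<in>i. ptime G e j < \<infinity>) \<and>
     (\<forall>e\<in>resources G. prec G e \<subseteq> players G \<times> players G \<and>
        strict_linear_order_on (players G) (prec G e) \<and>
        (\<forall>(k, j)\<in>prec G e. smith_ratio G e k \<le> smith_ratio G e j))"

definition uniform_smith_ratios :: "('j, 'e) game \<Rightarrow> bool" where
  "uniform_smith_ratios G \<longleftrightarrow>
     (\<forall>e\<in>resources G. \<exists>l::real. l \<ge> 0 \<and>
        (\<forall>j\<in>players G. ptime G e j \<in> {ennreal (l * weight G j), \<infinity>}))"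

(* Real-valued versions of processing times and Smith ratios.  They send infinity to 0.  In a
   congestion game this value is never used for a player who can choose e; for all
   other players k the load z_ek is 0, so every term containing it is 0, as required. *)
definition rptime :: "('j, 'e) game \<Rightarrow> 'e \<Rightarrow> 'j \<Rightarrow> real" where
  "rptime G e j = enn2real (ptime G e j)"

definition rsmith_ratio :: "('j, 'e) game \<Rightarrow> 'e \<Rightarrow> 'j \<Rightarrow> real" where
  "rsmith_ratio G e j = enn2real (smith_ratio G e j)"

(* Assignments are functions x with x j i = x_ij; values at i outside strategies G j are
   irrelevant. *)
definition assignment :: "('j, 'e) game \<Rightarrow> ('j \<Rightarrow> 'e set \<Rightarrow> real) \<Rightarrow> bool" where
  "assignment G x \<longleftrightarrow>
     (\<forall>j\<in>players G. (\<forall>i\<in>strategies G j. x j i \<ge> 0) \<and> (\<Sum>i\<in>strategies G j. x j i) = 1)"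

definition pure_assignment :: "('j, 'e) game \<Rightarrow> ('j \<Rightarrow> 'e set \<Rightarrow> real) \<Rightarrow> bool" where
  "pure_assignment G x \<longleftrightarrow>
     assignment G x \<and> (\<forall>j\<in>players G. \<forall>i\<in>strategies G j. x j i \<in> {0, 1})"

definition load :: "('j, 'e) game \<Rightarrow> ('j \<Rightarrow> 'e set \<Rightarrow> real) \<Rightarrow> 'e \<Rightarrow> 'j \<Rightarrow> real" where
  "load G x e j = (\<Sum>i\<in>{i\<in>strategies G j. e \<in> i}. x j i)"

(* A summand with both Smith ratios 0 is 0, since x / 0 = 0 in HOL. *)
definition rand_player_cost ::
    "('j, 'e) game \<Rightarrow> ('j \<Rightarrow> 'e set \<Rightarrow> real) \<Rightarrow> 'j \<Rightarrow> real" where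
  "rand_player_cost G x j =
     (\<Sum>i\<in>strategies G j. x j i *
       (\<Sum>e\<in>i. rptime G e j +
         (\<Sum>k\<in>players G - {j}.
            rsmith_ratio G e j / (rsmith_ratio G e j + rsmith_ratio G e k)
              * rptime G e k * load G x e k)))"

definition rand_cost :: "('j, 'e) game \<Rightarrow> ('j \<Rightarrow> 'e set \<Rightarrow> real) \<Rightarrow> real" where
  "rand_cost G x = (\<Sum>j\<in>players G. weight G j * rand_player_cost G x j)"

definition deviate ::
    "('j \<Rightarrow> 'e set \<Rightarrow> real) \<Rightarrow> 'j \<Rightarrow> 'e set \<Rightarrow> ('j \<Rightarrow> 'e set \<Rightarrow> real)" where
  "deviate x j i = x(j := (\<lambda>i'. if i' = i then 1 else 0))"

definition rand_nash :: "('j, 'e) game \<Rightarrow> ('j \<Rightarrow> 'e set \<Rightarrow> real) \<Rightarrow> bool" where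
  "rand_nash G x \<longleftrightarrow>
     assignment G x \<and>
     (\<forall>j\<in>players G. \<forall>i\<in>strategies G j.
        rand_player_cost G x j \<le> rand_player_cost G (deviate x j i) j)"

definition smith_cost :: "('j, 'e) game \<Rightarrow> ('j \<Rightarrow> 'e set \<Rightarrow> real) \<Rightarrow> real" where
  "smith_cost G x =
     (\<Sum>j\<in>players G. weight G j *
       (\<Sum>i\<in>strategies G j. x j i *
         (\<Sum>e\<in>i. rptime G e j +
           (\<Sum>k\<in>{k\<in>players G. (k, j) \<in> prec G e}. rptime G e k * load G x e k))))"

(* Taken in ennreal, so a positive equilibrium cost against optimum 0 has ratio infinity,
   and 0 / 0 = 0. *)
definition rand_coordination_ratio :: "('j, 'e) game \<Rightarrow> ennreal" where
  "rand_coordination_ratio G =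
     (SUP x\<in>{x. rand_nash G x}.
        ennreal (rand_cost G x) / (INF x'\<in>{x'. pure_assignment G x'}. ennreal (smith_cost G x')))"

(* Here v j i is the vector v_ij. *)
definition sdp_feasible ::
    "('j, 'e) game \<Rightarrow> nat \<Rightarrow> ('j \<Rightarrow> real) \<Rightarrow> real vec \<Rightarrow> ('j \<Rightarrow> 'e set \<Rightarrow> real vec) \<Rightarrow> bool" where
  "sdp_feasible G d y v0 v \<longleftrightarrow>
     v0 \<in> carrier_vec d \<and>
     (\<forall>j\<in>players G. \<forall>i\<in>strategies G j. v j i \<in> carrier_vec d) \<and>
     (\<forall>j\<in>players G. \<forall>i\<in>strategies G j.
        y j \<le> (\<Sum>e\<in>i. weight G j * rptime G e j) - 1/2 * (v j i \<bullet> v j i) + v0 \<bullet> v j i) \<and>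
     (\<forall>j\<in>players G. \<forall>k\<in>players G. \<forall>i\<in>strategies G j. \<forall>i'\<in>strategies G k.
        (i, j) \<noteq> (i', k) \<longrightarrow>
        v j i \<bullet> v k i' \<le>
          (\<Sum>e\<in>i \<inter> i'. weight G j * weight G k * min (rsmith_ratio G e j) (rsmith_ratio G e k)))"

definition sdp_objective :: "('j, 'e) game \<Rightarrow> ('j \<Rightarrow> real) \<Rightarrow> real vec \<Rightarrow> real" where
  "sdp_objective G y v0 = (\<Sum>j\<in>players G. y j) - 1/2 * (v0 \<bullet> v0)"

end

theory Submission
  imports Defs
begin

text \<open>
  Under uniform Smith ratios, with \<open>z\<close> the load and \<open>L e = (\<Sum>j. w j * z e j)\<close>, the cost of an
  equilibrium is \<open>C = (\<Sum>e. l e * ((\<Sum>j. (w j)\<^sup>2 * z e j * (1 - z e j / 2)) + (L e)\<^sup>2 / 2))\<close>.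
  Take vectors with one coordinate per resource: \<open>v0\<close> has entries \<open>b * sqrt (l e) * L e\<close>, and
  \<open>v j i\<close> has entries \<open>a * sqrt (l e) * w j\<close> for \<open>e \<in> i\<close> and 0 elsewhere; let \<open>y j = t * w j * C j\<close>.
  The equilibrium inequality gives the first SDP constraint if \<open>t \<le> 1 - a\<^sup>2 / 2\<close> and \<open>t / 2 \<le> a * b\<close>,
  and the second one needs \<open>a\<^sup>2 \<le> 1\<close>.  Since \<open>(\<Sum>e. l e * (L e)\<^sup>2) \<le> 2 * C\<close>, the objective is at
  least \<open>(t - b\<^sup>2) * C\<close>, and \<open>a\<^sup>2 = t = 2 / 3\<close>, \<open>b\<^sup>2 = 1 / 6\<close> make this \<open>C / 2\<close>.

  Conversely the SDP bounds the Smith's Rule optimum from below: summing the first constraint over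
  the strategies chosen in a pure assignment and using \<open>2 * (v0 \<bullet> V) \<le> v0 \<bullet> v0 + V \<bullet> V\<close> for the sum
  \<open>V\<close> of the chosen vectors leaves only the products of distinct chosen vectors, which the second
  constraint bounds by the waiting costs.
\<close>

section \<open>Congestion games\<close>

lemma congestion_gameD:
  assumes "congestion_game G" "j \<in> players G"
  shows "weight G j > 0" and "finite (strategies G j)"
    and "\<And>i. i \<in> strategies G j \<Longrightarrow> i \<subseteq> resources G"
    and "\<And>i. i \<in> strategies G j \<Longrightarrow> finite i"
    and "\<And>i e. i \<in> strategies G j \<Longrightarrow> e \<in> i \<Longrightarrow> ptime G e j < \<infinity>"
proof -
  have fin: "finite (resources G)" and sub: "strategies G j \<subseteq> Pow (resources G)"
    using assms by (auto simp: congestion_game_def)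
  show "weight G j > 0" "\<And>i e. i \<in> strategies G j \<Longrightarrow> e \<in> i \<Longrightarrow> ptime G e j < \<infinity>"
    using assms by (auto simp: congestion_game_def)
  show "finite (strategies G j)"
    using sub fin by (rule finite_subset[OF _ finite_Pow_iff[THEN iffD2]])
  show *: "\<And>i. i \<in> strategies G j \<Longrightarrow> i \<subseteq> resources G" using sub by auto
  show "\<And>i. i \<in> strategies G j \<Longrightarrow> finite i" using finite_subset[OF * fin] .
qed

text \<open>Exchanging the two sums collects, for each resource, the probability of all strategies
  containing it. Costs thereby depend on \<open>x\<close> only through the loads.\<close>

lemma sum_over_strategies:
  assumes "congestion_game G" "j \<in> players G"
  shows "(\<Sum>i\<in>strategies G j. x j i * (\<Sum>e\<in>i. f e)) = (\<Sum>e\<in>resources G. load G x e j * f e)"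
proof -
  note game = congestion_gameD[OF assms]
  have fin: "finite (resources G)" using assms by (simp add: congestion_game_def)
  have "(\<Sum>i\<in>strategies G j. x j i * (\<Sum>e\<in>i. f e))
      = (\<Sum>i\<in>strategies G j. \<Sum>e\<in>resources G. if e \<in> i then x j i * f e else 0)"
    by (rule sum.cong[OF refl])
      (use game(3) in \<open>simp add: sum_distrib_left flip: sum.inter_restrict[OF fin],
        metis Int_absorb1\<close>)
  also have "\<dots> = (\<Sum>e\<in>resources G. \<Sum>i\<in>strategies G j. if e \<in> i then x j i * f e else 0)"
    by (rule sum.swap)
  also have "\<dots> = (\<Sum>e\<in>resources G. load G x e j * f e)"
    by (rule sum.cong[OF refl])
      (auto simp: load_def sum_distrib_right sum.inter_filter[OF game(2)] intro!: sum.cong)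
  finally show ?thesis .
qed

lemma load_bounds:
  assumes "congestion_game G" "assignment G x" "j \<in> players G"
  shows "0 \<le> load G x e j" "load G x e j \<le> 1"
proof -
  have nn: "\<And>i. i \<in> strategies G j \<Longrightarrow> 0 \<le> x j i" and one: "(\<Sum>i\<in>strategies G j. x j i) = 1"
    using assms by (auto simp: assignment_def)
  show "0 \<le> load G x e j" unfolding load_def by (rule sum_nonneg) (use nn in auto)
  show "load G x e j \<le> 1" unfolding load_def one[symmetric]
    by (rule sum_mono2) (use nn congestion_gameD(2)[OF assms(1,3)] in auto)
qed

text \<open>An infinite processing time also makes the Smith ratio infinite, and
  \<open>enn2real\<close> sends both to 0, so the identity survives that case.\<close>

lemma weight_mult_rsmith_ratio:
  assumes "weight G j > 0"
  shows "weight G j * rsmith_ratio G e j = rptime G e j"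
  using assms
  by (cases "ptime G e j")
    (auto simp: rsmith_ratio_def smith_ratio_def rptime_def divide_ennreal ennreal_top_divide)

text \<open>The waiting terms involve only loads of players other than \<open>j\<close>, which a
  deviation of \<open>j\<close> leaves unchanged.\<close>

lemma rand_player_cost_deviate:
  assumes "congestion_game G" "j \<in> players G" "i \<in> strategies G j"
  shows "rand_player_cost G (deviate x j i) j =
    (\<Sum>e\<in>i. rptime G e j + (\<Sum>k\<in>players G - {j}.
        rsmith_ratio G e j / (rsmith_ratio G e j + rsmith_ratio G e k)
          * rptime G e k * load G x e k))"
proof -
  have "load G (deviate x j i) e k = load G x e k" if "k \<in> players G - {j}" for e k
    using that by (simp add: load_def deviate_def)
  then show ?thesis
    using congestion_gameD(2)[OF assms(1,2)] assms(3)
    by (simp add: rand_player_cost_def) (simp add: deviate_def if_distrib[of "\<lambda>a. a * _"] cong: if_cong)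
qed

section \<open>Weak duality\<close>

text \<open>Each unordered pair occurs twice on the left, while the order selects exactly one of its
  two orientations on the right.\<close>

lemma sum_sum_symmetric_linear_order:
  fixes f :: "'a \<Rightarrow> 'a \<Rightarrow> real"
  assumes "finite A" "strict_linear_order_on A r"
    and sym: "\<And>j k. j \<in> A \<Longrightarrow> k \<in> A \<Longrightarrow> f j k = f k j"
  shows "(\<Sum>j\<in>A. \<Sum>k\<in>A - {j}. f j k) = 2 * (\<Sum>j\<in>A. \<Sum>k\<in>{k\<in>A. (k, j) \<in> r}. f j k)"
proof -
  have trans: "trans r" and irrefl: "irrefl r" and total: "total_on A r"
    using assms(2) by (auto simp: strict_linear_order_on_def)
  have "(\<Sum>k\<in>A - {j}. f j k) = (\<Sum>k\<in>{k\<in>A. (k, j) \<in> r}. f j k) + (\<Sum>k\<in>{k\<in>A. (j, k) \<in> r}. f j k)"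
    if "j \<in> A" for j
  proof -
    have "A - {j} = {k\<in>A. (k, j) \<in> r} \<union> {k\<in>A. (j, k) \<in> r}"
      using that total irrefl by (auto simp: total_on_def irrefl_def)
    moreover have "{k\<in>A. (k, j) \<in> r} \<inter> {k\<in>A. (j, k) \<in> r} = {}"
      using trans irrefl by (auto simp: irrefl_def dest: transD)
    ultimately show ?thesis using assms(1) by (simp add: sum.union_disjoint)
  qed
  moreover have "(\<Sum>j\<in>A. \<Sum>k\<in>{k\<in>A. (j, k) \<in> r}. f j k) = (\<Sum>j\<in>A. \<Sum>k\<in>{k\<in>A. (k, j) \<in> r}. f j k)"
    using sum.swap_restrict[OF assms(1,1), of f "\<lambda>j k. (j, k) \<in> r"] sym by simp
  ultimately show ?thesis by (simp add: sum.distrib)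
qed

text \<open>This is the nonnegativity of the squared distance between \<open>v0\<close> and the sum
  of the \<open>u j\<close>, expanded coordinate by coordinate.\<close>

lemma scalar_prod_sum_Gram:
  fixes v0 :: "real vec" and u :: "'a \<Rightarrow> real vec"
  assumes "finite A" "v0 \<in> carrier_vec d" "\<And>j. j \<in> A \<Longrightarrow> u j \<in> carrier_vec d"
  shows "2 * (\<Sum>j\<in>A. v0 \<bullet> u j) \<le> v0 \<bullet> v0 + (\<Sum>j\<in>A. \<Sum>k\<in>A. u j \<bullet> u k)"
proof -
  have prod: "a \<bullet> u j = (\<Sum>n<d. a $ n * u j $ n)" if "j \<in> A" for a j
    using assms(3)[OF that] by (simp add: scalar_prod_def lessThan_atLeast0)
  have 1: "(\<Sum>j\<in>A. v0 \<bullet> u j) = (\<Sum>n<d. v0 $ n * (\<Sum>j\<in>A. u j $ n))"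
    by (simp add: prod sum_distrib_left sum.swap[of _ A])
  have "(\<Sum>j\<in>A. \<Sum>k\<in>A. u j \<bullet> u k) = (\<Sum>j\<in>A. \<Sum>n<d. u j $ n * (\<Sum>k\<in>A. u k $ n))"
    by (simp add: prod sum_distrib_left sum.swap[of _ A "{..<d}"])
  also have "\<dots> = (\<Sum>n<d. \<Sum>j\<in>A. u j $ n * (\<Sum>k\<in>A. u k $ n))" by (rule sum.swap)
  also have "\<dots> = (\<Sum>n<d. (\<Sum>j\<in>A. u j $ n)\<^sup>2)"
    by (simp add: power2_eq_square sum_distrib_right)
  finally have 2: "(\<Sum>j\<in>A. \<Sum>k\<in>A. u j \<bullet> u k) = (\<Sum>n<d. (\<Sum>j\<in>A. u j $ n)\<^sup>2)" .
  have 3: "v0 \<bullet> v0 = (\<Sum>n<d. (v0 $ n)\<^sup>2)"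
    using assms by (simp add: scalar_prod_def lessThan_atLeast0 power2_eq_square)
  have "0 \<le> (\<Sum>n<d. (v0 $ n - (\<Sum>j\<in>A. u j $ n))\<^sup>2)" by (simp add: sum_nonneg)
  then show ?thesis
    by (simp add: 1 2 3 power2_diff sum.distrib sum_subtractf sum_distrib_left mult.assoc)
qed

lemma pure_assignment_choice:
  assumes "congestion_game G" "pure_assignment G x"
  obtains s where "\<And>j. j \<in> players G \<Longrightarrow> s j \<in> strategies G j"
    and "\<And>j i. j \<in> players G \<Longrightarrow> i \<in> strategies G j \<Longrightarrow> x j i = (if i = s j then 1 else 0)"
proof -
  have "\<exists>s. s \<in> strategies G j \<and> (\<forall>i\<in>strategies G j. x j i = (if i = s then 1 else 0))"
    if j: "j \<in> players G" for j
  proof -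
    note fin = congestion_gameD(2)[OF assms(1) j]
    have one: "(\<Sum>i\<in>strategies G j. x j i) = 1"
      and val: "\<And>i. i \<in> strategies G j \<Longrightarrow> x j i \<in> {0, 1}"
      using assms(2) j by (auto simp: pure_assignment_def assignment_def)
    then obtain s where s: "s \<in> strategies G j" "x j s = 1"
      by (metis insertE singletonD sum.neutral zero_neq_one)
    \<comment> \<open>One strategy already carries the whole probability 1, so the other nonnegative
      values sum to 0 and each of them vanishes.\<close>
    have "(\<Sum>i\<in>strategies G j - {s}. x j i) = 0"
      using one s fin by (simp add: sum_diff1)
    then have "\<forall>i\<in>strategies G j - {s}. x j i = 0"
      using fin val by (subst (asm) sum_nonneg_eq_0_iff) force+
    with s show ?thesis by auto
  qed
  then show thesis using that by metis
qed

lemma sdp_weak_duality: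
  assumes G: "congestion_game G" and sdp: "sdp_feasible G d y v0 v" and pure: "pure_assignment G x"
  shows "sdp_objective G y v0 \<le> smith_cost G x"
proof -
  define P where "P = players G"
  define R where "R = resources G"
  define w where "w = weight G"
  define \<delta> where "\<delta> = rsmith_ratio G"
  obtain s where s: "\<And>j. j \<in> P \<Longrightarrow> s j \<in> strategies G j"
    and xs: "\<And>j i. j \<in> P \<Longrightarrow> i \<in> strategies G j \<Longrightarrow> x j i = (if i = s j then 1 else 0)"
    using pure_assignment_choice[OF G pure] unfolding P_def by metis
  have fin: "finite P" "finite R" using G by (auto simp: congestion_game_def P_def R_def)
  note game = congestion_gameD[OF G, folded P_def R_def w_def]
  have load: "load G x e j = (if e \<in> s j then 1 else 0)" if "j \<in> P" for e j
  proof -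
    have "load G x e j = (\<Sum>i\<in>{i\<in>strategies G j. e \<in> i}. if i = s j then 1 else 0)"
      unfolding load_def by (rule sum.cong) (use that xs in auto)
    then show ?thesis using that s game(2) by simp
  qed
  \<comment> \<open>Extending the bound by 0 to all resources gives it an index set independent of
    \<open>j\<close> and \<open>k\<close>, so that the sums can be swapped.\<close>
  define f where "f = (\<lambda>e j k. if e \<in> s j \<and> e \<in> s k then w j * w k * min (\<delta> e j) (\<delta> e k) else 0)"
  define u where "u = (\<lambda>j. v j (s j))"
  have v0: "v0 \<in> carrier_vec d" and u: "\<And>j. j \<in> P \<Longrightarrow> u j \<in> carrier_vec d"
    and y: "\<And>j. j \<in> P \<Longrightarrow> y j \<le> (\<Sum>e\<in>s j. w j * rptime G e j) - 1/2 * (u j \<bullet> u j) + v0 \<bullet> u j"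
    using sdp s by (auto simp: sdp_feasible_def P_def u_def w_def)
  have uu: "u j \<bullet> u k \<le> (\<Sum>e\<in>R. f e j k)" if "j \<in> P" "k \<in> P - {j}" for j k
  proof -
    have "u j \<bullet> u k \<le> (\<Sum>e\<in>s j \<inter> s k. w j * w k * min (\<delta> e j) (\<delta> e k))"
      using sdp s that by (auto simp: sdp_feasible_def P_def u_def w_def \<delta>_def)
    also have "\<dots> = (\<Sum>e\<in>R. f e j k)"
      unfolding f_def using that game(3)[OF _ s] fin
      by (intro sum.mono_neutral_cong_left) auto
    finally show ?thesis .
  qed
  \<comment> \<open>The diagonal is split off: the second SDP constraint covers distinct pairs only,
    and the squared norms later cancel against those in the first constraint.\<close>
  have "(\<Sum>j\<in>P. \<Sum>k\<in>P. u j \<bullet> u k) = (\<Sum>j\<in>P. u j \<bullet> u j) + (\<Sum>j\<in>P. \<Sum>k\<in>P - {j}. u j \<bullet> u k)"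
    using fin by (simp add: sum.remove flip: sum.distrib)
  also have "(\<Sum>j\<in>P. \<Sum>k\<in>P - {j}. u j \<bullet> u k) \<le> (\<Sum>j\<in>P. \<Sum>k\<in>P - {j}. \<Sum>e\<in>R. f e j k)"
    by (intro sum_mono uu)
  also have "\<dots> = (\<Sum>e\<in>R. \<Sum>j\<in>P. \<Sum>k\<in>P - {j}. f e j k)"
    by (simp add: sum.swap[of _ R])
  also have "\<dots> = (\<Sum>e\<in>R. 2 * (\<Sum>j\<in>P. \<Sum>k\<in>{k\<in>P. (k, j) \<in> prec G e}. f e j k))"
    using G fin by (intro sum.cong refl sum_sum_symmetric_linear_order)
      (auto simp: congestion_game_def P_def R_def f_def min.commute)
  also have "\<dots> = 2 * (\<Sum>e\<in>R. \<Sum>j\<in>P. \<Sum>k\<in>{k\<in>P. (k, j) \<in> prec G e}. f e j k)"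
    by (simp add: sum_distrib_left)
  also have "(\<Sum>e\<in>R. \<Sum>j\<in>P. \<Sum>k\<in>{k\<in>P. (k, j) \<in> prec G e}. f e j k)
      = (\<Sum>e\<in>R. \<Sum>j\<in>P. \<Sum>k\<in>{k\<in>P. (k, j) \<in> prec G e}.
          w j * load G x e j * (rptime G e k * load G x e k))"
  proof (intro sum.cong refl)
    fix e j k assume e: "e \<in> R" and j: "j \<in> P" and "k \<in> {k\<in>P. (k, j) \<in> prec G e}"
    then have k: "k \<in> P" "(k, j) \<in> prec G e" by auto
    show "f e j k = w j * load G x e j * (rptime G e k * load G x e k)"
    proof (cases "e \<in> s j \<and> e \<in> s k")
      case True
      have "smith_ratio G e k \<le> smith_ratio G e j"
        using G e k by (auto simp: congestion_game_def R_def)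
      \<comment> \<open>Finiteness of the larger ratio is what makes \<open>enn2real\<close>
        monotone here, since an infinite ratio would drop to 0.\<close>
      moreover have "smith_ratio G e j < \<infinity>"
        using game(5)[OF j s[OF j]] True game(1)[OF j]
        by (auto simp: smith_ratio_def w_def ennreal_divide_eq_top_iff simp flip: less_top)
      ultimately have "\<delta> e k \<le> \<delta> e j"
        by (simp add: \<delta>_def rsmith_ratio_def enn2real_mono)
      \<comment> \<open>The minimum is the ratio of the earlier player \<open>k\<close>, and
        \<open>w k * \<delta> e k\<close> is the processing time for which \<open>j\<close>
        waits.\<close>
      then show ?thesis
        using True j k weight_mult_rsmith_ratio[OF game(1)[unfolded w_def], of k e]
        by (simp add: f_def load w_def \<delta>_def)
    qed (use j k in \<open>auto simp: f_def load\<close>)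
  qed
  finally have Gram: "(\<Sum>j\<in>P. \<Sum>k\<in>P. u j \<bullet> u k) \<le> (\<Sum>j\<in>P. u j \<bullet> u j) +
      2 * (\<Sum>e\<in>R. \<Sum>j\<in>P. \<Sum>k\<in>{k\<in>P. (k, j) \<in> prec G e}.
          w j * load G x e j * (rptime G e k * load G x e k))" by simp
  have own: "(\<Sum>e\<in>s j. w j * rptime G e j) = (\<Sum>e\<in>R. w j * load G x e j * rptime G e j)"
    if "j \<in> P" for j
    using that load game(3)[OF _ s] fin by (intro sum.mono_neutral_cong_left) auto
  have "smith_cost G x = (\<Sum>j\<in>P. w j * (\<Sum>e\<in>R. load G x e j * (rptime G e j +
      (\<Sum>k\<in>{k\<in>P. (k, j) \<in> prec G e}. rptime G e k * load G x e k))))"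
    unfolding smith_cost_def P_def R_def w_def by (simp add: sum_over_strategies[OF G])
  also have "\<dots> = (\<Sum>j\<in>P. \<Sum>e\<in>s j. w j * rptime G e j) + (\<Sum>e\<in>R. \<Sum>j\<in>P. \<Sum>k\<in>{k\<in>P. (k, j) \<in> prec G e}.
          w j * load G x e j * (rptime G e k * load G x e k))"
    unfolding sum.swap[of _ P R]
    by (simp add: own algebra_simps sum.distrib sum_distrib_left)
  finally have cost: "smith_cost G x = \<dots>" .
  have "(\<Sum>j\<in>P. y j) \<le> (\<Sum>j\<in>P. (\<Sum>e\<in>s j. w j * rptime G e j) - 1/2 * (u j \<bullet> u j) + v0 \<bullet> u j)"
    by (intro sum_mono y)
  also have "\<dots> = (\<Sum>j\<in>P. \<Sum>e\<in>s j. w j * rptime G e j) - 1/2 * (\<Sum>j\<in>P. u j \<bullet> u j) + (\<Sum>j\<in>P. v0 \<bullet> u j)"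
    by (simp add: sum.distrib sum_subtractf sum_distrib_left)
  finally show ?thesis
    using Gram cost scalar_prod_sum_Gram[of P v0 d u, OF fin(1) v0 u] unfolding sdp_objective_def P_def[symmetric]
    by linarith
qed

section \<open>Uniform Smith ratios\<close>

context
  fixes G :: "('j, 'e) game" and l :: "'e \<Rightarrow> real"
  assumes game: "congestion_game G"
    and l_nonneg: "\<And>e. e \<in> resources G \<Longrightarrow> 0 \<le> l e"
    and ptime: "\<And>e j. e \<in> resources G \<Longrightarrow> j \<in> players G \<Longrightarrow> ptime G e j \<in> {ennreal (l e * weight G j), \<infinity>}"
begin

text \<open>Processing times on a player's own strategies are finite, which rules out the infinite
  alternative.\<close>

lemma uniform_rptime:
  assumes "j \<in> players G" "i \<in> strategies G j" "e \<in> i"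
  shows "rptime G e j = l e * weight G j" "rsmith_ratio G e j = l e"
proof -
  note D = congestion_gameD[OF game assms(1)]
  have e: "e \<in> resources G" using D(3) assms by auto
  show *: "rptime G e j = l e * weight G j"
    using ptime[OF e assms(1)] D(5)[OF assms(2,3)] l_nonneg[OF e] D(1)
    by (auto simp: rptime_def)
  show "rsmith_ratio G e j = l e"
    using weight_mult_rsmith_ratio[OF D(1), of e] D(1) * by simp
qed

text \<open>Equal Smith ratios put either player first with probability 1/2, so a player waits for
  half the load of the others.\<close>

lemma uniform_resource_cost:
  assumes "j \<in> players G" "i \<in> strategies G j" "e \<in> i"
  shows "rptime G e j + (\<Sum>k\<in>players G - {j}.
      rsmith_ratio G e j / (rsmith_ratio G e j + rsmith_ratio G e k) * rptime G e k * load G x e k)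
    = l e * (weight G j
        + 1/2 * ((\<Sum>k\<in>players G. weight G k * load G x e k) - weight G j * load G x e j))"
proof -
  have cross: "rsmith_ratio G e j / (rsmith_ratio G e j + rsmith_ratio G e k) * rptime G e k * load G x e k
      = l e * (1/2 * (weight G k * load G x e k))" if k: "k \<in> players G" for k
  \<comment> \<open>A player who cannot choose \<open>e\<close> has load 0 there. Otherwise both
    ratios equal \<open>l e\<close>; if this is 0, both sides vanish.\<close>
  proof (cases "{i\<in>strategies G k. e \<in> i} = {}")
    case True
    then show ?thesis unfolding load_def by (metis mult_zero_right sum.empty)
  next
    case False
    then show ?thesis using uniform_rptime[OF assms] uniform_rptime[OF k] by auto
  qed
  have "(\<Sum>k\<in>players G - {j}.
      rsmith_ratio G e j / (rsmith_ratio G e j + rsmith_ratio G e k) * rptime G e k * load G x e k)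
    = l e * (1/2 * (\<Sum>k\<in>players G - {j}. weight G k * load G x e k))"
    unfolding sum_distrib_left by (intro sum.cong refl cross) simp
  then show ?thesis
    using uniform_rptime[OF assms] game assms(1) by (simp only: distrib_left) (simp add: sum_diff1 congestion_game_def)
qed

text \<open>Summing \<open>w j * z e j * L e / 2\<close> over \<open>j\<close> yields the square of
  the load; removing each player's wait for itself produces the factor
  \<open>1 - z e j / 2\<close>.\<close>

lemma uniform_rand_cost:
  "rand_cost G x = (\<Sum>e\<in>resources G. l e * ((\<Sum>j\<in>players G.
      (weight G j)\<^sup>2 * (load G x e j * (1 - 1/2 * load G x e j)))
    + 1/2 * (\<Sum>j\<in>players G. weight G j * load G x e j)\<^sup>2))"
proof -
  define L where "L = (\<lambda>e. \<Sum>j\<in>players G. weight G j * load G x e j)"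
  have "rand_cost G x = (\<Sum>j\<in>players G. weight G j * (\<Sum>e\<in>resources G. load G x e j *
      (l e * (weight G j + 1/2 * (L e - weight G j * load G x e j)))))"
    unfolding rand_cost_def rand_player_cost_def L_def
    by (simp add: uniform_resource_cost sum_over_strategies[OF game] del: times_divide_eq_left)
  also have "\<dots> = (\<Sum>j\<in>players G. \<Sum>e\<in>resources G. l e *
      ((weight G j)\<^sup>2 * (load G x e j * (1 - 1/2 * load G x e j))
       + 1/2 * L e * (weight G j * load G x e j)))"
    by (simp add: sum_distrib_left algebra_simps power2_eq_square)
  also have "\<dots> = (\<Sum>e\<in>resources G. \<Sum>j\<in>players G. l e *
      ((weight G j)\<^sup>2 * (load G x e j * (1 - 1/2 * load G x e j))
       + 1/2 * L e * (weight G j * load G x e j)))"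
    by (rule sum.swap)
  also have "\<dots> = (\<Sum>e\<in>resources G. l e *
      ((\<Sum>j\<in>players G. (weight G j)\<^sup>2 * (load G x e j * (1 - 1/2 * load G x e j)))
       + 1/2 * (L e)\<^sup>2))"
    by (simp only: sum_distrib_left[symmetric] sum.distrib L_def power2_eq_square mult.assoc)
  finally show ?thesis unfolding L_def .
qed

lemma uniform_nash_sdp:
  assumes nash: "rand_nash G x"
  shows "\<exists>d y v0 v. sdp_feasible G d y v0 v \<and> sdp_objective G y v0 \<ge> 1/2 * rand_cost G x"
proof -
  define P where "P = players G"
  define R where "R = resources G"
  define w where "w = weight G"
  define z where "z = load G x"
  define L where "L = (\<lambda>e. \<Sum>j\<in>P. w j * z e j)"
  have fin: "finite P" "finite R" using game by (auto simp: congestion_game_def P_def R_def)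
  have assn: "assignment G x" using nash by (simp add: rand_nash_def)
  note D = congestion_gameD[OF game, folded P_def R_def w_def]
  note z = load_bounds[OF game assn, folded P_def z_def]
  define d where "d = card R"
  \<comment> \<open>Vectors have natural number indices, so \<open>h\<close> enumerates the
    resources and scalar products become sums over \<open>R\<close>.\<close>
  obtain h where h: "bij_betw h {0..<d} R"
    using ex_bij_betw_nat_finite[OF fin(2)] d_def by auto
  have prod: "vec d (\<lambda>n. f (h n)) \<bullet> vec d (\<lambda>n. g (h n)) = (\<Sum>e\<in>R. f e * g e)" for f g :: "'e \<Rightarrow> real"
    using sum.reindex_bij_betw[OF h, of "\<lambda>e. f e * g e"] by (simp add: scalar_prod_def)
  \<comment> \<open>The constants satisfy \<open>a * b = t / 2 = 1 / 3\<close> and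
    \<open>1 - a\<^sup>2 / 2 = t\<close>, so both coefficient conditions of the first constraint are
    tight.\<close>
  define v0 where "v0 = vec d (\<lambda>n. sqrt (l (h n) / 6) * L (h n))"
  define v where "v = (\<lambda>j i. vec d (\<lambda>n. if h n \<in> i then sqrt (2 / 3 * l (h n)) * w j else 0))"
  define y where "y = (\<lambda>j. 2/3 * (w j * rand_player_cost G x j))"
  have l: "0 \<le> l e" if "e \<in> R" for e using l_nonneg that R_def by simp
  have v0v0: "v0 \<bullet> v0 = (\<Sum>e\<in>R. l e / 6 * (L e)\<^sup>2)"
    unfolding v0_def prod[of "\<lambda>e. sqrt (l e / 6) * L e" "\<lambda>e. sqrt (l e / 6) * L e"]
    by (intro sum.cong refl) (use l in \<open>simp add: power2_eq_square[symmetric] power_mult_distrib\<close>)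
  have vv: "v j i \<bullet> v k i' = (\<Sum>e\<in>i \<inter> i'. 2/3 * l e * (w j * w k))"
    if "i \<subseteq> R" "i' \<subseteq> R" for i i' j k
  proof -
    have "v j i \<bullet> v k i' = (\<Sum>e\<in>R. (if e \<in> i then sqrt (2 / 3 * l e) * w j else 0) *
        (if e \<in> i' then sqrt (2 / 3 * l e) * w k else 0))"
      unfolding v_def by (rule prod)
    also have "\<dots> = (\<Sum>e\<in>i \<inter> i'. 2/3 * l e * (w j * w k))"
    proof (intro sum.mono_neutral_cong_right fin(2))
      fix e assume e: "e \<in> i \<inter> i'"
      have "sqrt (2/3 * l e) * sqrt (2/3 * l e) = 2/3 * l e"
        using l e that by (intro real_sqrt_mult_self[THEN trans] abs_of_nonneg) auto
      then show "(if e \<in> i then sqrt (2 / 3 * l e) * w j else 0) *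
          (if e \<in> i' then sqrt (2 / 3 * l e) * w k else 0) = 2/3 * l e * (w j * w k)"
        using e by (simp only: Int_iff if_True) (metis mult.assoc mult.commute)
    qed (use that in auto)
    finally show ?thesis .
  qed
  have v0v: "v0 \<bullet> v j i = (\<Sum>e\<in>i. 1/3 * l e * (w j * L e))" if "i \<subseteq> R" for i j
  proof -
    have "v0 \<bullet> v j i = (\<Sum>e\<in>R. (sqrt (l e / 6) * L e) * (if e \<in> i then sqrt (2 / 3 * l e) * w j else 0))"
      unfolding v_def v0_def by (rule prod)
    also have "\<dots> = (\<Sum>e\<in>i. 1/3 * l e * (w j * L e))"
    proof (intro sum.mono_neutral_cong_right fin(2))
      fix e assume e: "e \<in> i"
      have "sqrt (l e / 6) * sqrt (2/3 * l e) = sqrt ((1/3 * l e)\<^sup>2)"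
        by (simp add: real_sqrt_mult[symmetric] power2_eq_square)
      also have "\<dots> = 1/3 * l e" using l e that by (subst real_sqrt_abs) auto
      finally show "(sqrt (l e / 6) * L e) * (if e \<in> i then sqrt (2 / 3 * l e) * w j else 0)
          = 1/3 * l e * (w j * L e)"
        using e by (simp only: if_True) (metis mult.assoc mult.commute)
    qed (use that in auto)
    finally show ?thesis .
  qed
  have ybound: "y j \<le> (\<Sum>e\<in>i. w j * rptime G e j) - 1/2 * (v j i \<bullet> v j i) + v0 \<bullet> v j i"
    if j: "j \<in> P" and i: "i \<in> strategies G j" for j i
  proof -
    have iR: "i \<subseteq> R" using D(3) j i by simp
    have "rand_player_cost G x j \<le> rand_player_cost G (deviate x j i) j"
      using nash j i by (auto simp: rand_nash_def P_def)
    also have "\<dots> = (\<Sum>e\<in>i. l e * (w j + 1/2 * (L e - w j * z e j)))"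
      using j i unfolding P_def L_def w_def z_def
      by (simp add: rand_player_cost_deviate[OF game] uniform_resource_cost del: times_divide_eq_left)
    \<comment> \<open>Restoring the player's own nonnegative load only increases the bound and
      leaves the full \<open>L e\<close>, as in \<open>v0\<close>.\<close>
    also have "\<dots> \<le> (\<Sum>e\<in>i. l e * (w j + 1/2 * L e))"
    proof (intro sum_mono mult_left_mono)
      fix e assume "e \<in> i"
      show "w j + 1/2 * (L e - w j * z e j) \<le> w j + 1/2 * L e"
        using z(1)[OF j] D(1)[OF j] by simp
      show "0 \<le> l e" using \<open>e \<in> i\<close> iR l by auto
    qed
    finally have "y j \<le> 2/3 * (w j * (\<Sum>e\<in>i. l e * (w j + 1/2 * L e)))"
      unfolding y_def using D(1)[OF j] by simp
    \<comment> \<open>Coefficients match: \<open>1 - 1/3 = 2/3\<close> for the squared weight, and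
      half of 2/3 for \<open>w j * L e\<close>.\<close>
    also have "\<dots> = (\<Sum>e\<in>i. w j * (l e * w j)) - 1/2 * (\<Sum>e\<in>i. 2/3 * l e * (w j * w j))
        + (\<Sum>e\<in>i. 1/3 * l e * (w j * L e))"
      unfolding sum_distrib_left sum_subtractf[symmetric] sum.distrib[symmetric]
      by (intro sum.cong refl) (simp add: field_simps)
    also have "\<dots> = (\<Sum>e\<in>i. w j * rptime G e j) - 1/2 * (v j i \<bullet> v j i) + v0 \<bullet> v j i"
      using j i by (simp add: vv[OF iR iR] v0v[OF iR] uniform_rptime P_def w_def)
    finally show ?thesis .
  qed
  have vbound: "v j i \<bullet> v k i' \<le>
      (\<Sum>e\<in>i \<inter> i'. w j * w k * min (rsmith_ratio G e j) (rsmith_ratio G e k))"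
    if j: "j \<in> P" and k: "k \<in> P" and i: "i \<in> strategies G j" and i': "i' \<in> strategies G k" for j k i i'
  proof -
    have sub: "i \<subseteq> R" "i' \<subseteq> R" using D(3) j k i i' by auto
    show ?thesis unfolding vv[OF sub]
    proof (rule sum_mono)
      fix e assume e: "e \<in> i \<inter> i'"
      have "0 \<le> l e * (w j * w k)" using e sub l D(1)[OF j] D(1)[OF k] by auto
      then show "2/3 * l e * (w j * w k) \<le> w j * w k * min (rsmith_ratio G e j) (rsmith_ratio G e k)"
        using e uniform_rptime(2)[of j i e] uniform_rptime(2)[of k i' e] j k i i'
        by (simp add: P_def algebra_simps)
    qed
  qed
  have "sdp_feasible G d y v0 v"
    unfolding sdp_feasible_def P_def[symmetric] w_def[symmetric]
    using ybound vbound by (auto simp: v0_def v_def)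
  moreover have "1/2 * rand_cost G x \<le> sdp_objective G y v0"
  proof -
    have C: "rand_cost G x = (\<Sum>e\<in>R. l e * ((\<Sum>j\<in>P. (w j)\<^sup>2 * (z e j * (1 - 1/2 * z e j))) + 1/2 * (L e)\<^sup>2))"
      using uniform_rand_cost unfolding P_def R_def w_def z_def L_def .
    \<comment> \<open>Loads lie between 0 and 1, so the discarded terms with
      \<open>z e j * (1 - z e j / 2)\<close> are nonnegative.\<close>
    have "(\<Sum>e\<in>R. l e * (1/2 * (L e)\<^sup>2)) \<le> rand_cost G x"
      unfolding C
    proof (intro sum_mono mult_left_mono)
      fix e assume "e \<in> R"
      have "0 \<le> (w j)\<^sup>2 * (z e j * (1 - 1/2 * z e j))" if "j \<in> P" for j
        using z[OF that, of e] by simp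
      then show "1/2 * (L e)\<^sup>2 \<le> (\<Sum>j\<in>P. (w j)\<^sup>2 * (z e j * (1 - 1/2 * z e j))) + 1/2 * (L e)\<^sup>2"
        by (simp add: sum_nonneg)
    qed (use l in simp)
    moreover have "(\<Sum>e\<in>R. l e * (1/2 * (L e)\<^sup>2)) = 3 * (v0 \<bullet> v0)"
      unfolding v0v0 sum_distrib_left by (simp add: algebra_simps)
    moreover have "sdp_objective G y v0 = 2/3 * rand_cost G x - 1/2 * (v0 \<bullet> v0)"
      by (simp add: sdp_objective_def y_def rand_cost_def P_def w_def sum_distrib_left)
    \<comment> \<open>Thus \<open>v0 \<bullet> v0\<close> is at most a third of the cost, and
      \<open>2/3 - 1/6 = 1/2\<close>.\<close>
    ultimately show ?thesis by linarith
  qed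
  ultimately show ?thesis by blast
qed

end

theorem theorem4p9:
  fixes G :: "('j, 'e) game"
  assumes "congestion_game G" and "uniform_smith_ratios G"
  shows "(\<forall>x. rand_nash G x \<longrightarrow>
            (\<exists>d y v0 v. sdp_feasible G d y v0 v \<and> sdp_objective G y v0 \<ge> 1/2 * rand_cost G x)) \<and>
         (\<forall>x x'. rand_nash G x \<longrightarrow> pure_assignment G x' \<longrightarrow> rand_cost G x \<le> 2 * smith_cost G x') \<and>
         rand_coordination_ratio G \<le> 2"
proof -
  obtain l where l: "\<And>e. e \<in> resources G \<Longrightarrow> 0 \<le> l e"
    "\<And>e j. e \<in> resources G \<Longrightarrow> j \<in> players G \<Longrightarrow> ptime G e j \<in> {ennreal (l e * weight G j), \<infinity>}"
    using assms(2) unfolding uniform_smith_ratios_def by metis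
  have sdp: "\<exists>d y v0 v. sdp_feasible G d y v0 v \<and> sdp_objective G y v0 \<ge> 1/2 * rand_cost G x"
    if "rand_nash G x" for x
    using uniform_nash_sdp[OF assms(1) l that] .
  have ratio: "rand_cost G x \<le> 2 * smith_cost G x'" if "rand_nash G x" "pure_assignment G x'" for x x'
    using sdp[OF that(1)] sdp_weak_duality[OF assms(1) _ that(2)] by fastforce
  have "ennreal (rand_cost G x) / (INF x'\<in>{x'. pure_assignment G x'}. ennreal (smith_cost G x')) \<le> 2"
    (is "_ / ?I \<le> 2") if "rand_nash G x" for x
  proof -
    \<comment> \<open>Half the equilibrium cost is a lower bound for every pure Smith's Rule cost,
      hence for their infimum.\<close>
    have "ennreal (rand_cost G x / 2) \<le> ?I"
      by (intro INF_greatest ennreal_leI) (use ratio[OF that] in fastforce)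
    then have "2 * ennreal (rand_cost G x / 2) \<le> 2 * ?I"
      by (rule mult_left_mono) simp
    moreover have "2 * ennreal (rand_cost G x / 2) = ennreal (rand_cost G x)"
      using ennreal_mult'[of 2 "rand_cost G x / 2"] by simp
    ultimately have le: "ennreal (rand_cost G x) \<le> 2 * ?I" by simp
    show ?thesis
    \<comment> \<open>If the infimum is 0, then \<open>le\<close> forces the numerator to be 0, and
      the quotient is 0 by convention.\<close>
    proof (cases "?I = 0")
      case True
      with le show ?thesis by simp
    next
      case False
      with le show ?thesis by (simp add: divide_le_posI_ennreal mult.commute zero_less_iff_neq_zero)
    qed
  qed
  then have "rand_coordination_ratio G \<le> 2"
    unfolding rand_coordination_ratio_def by (auto intro: SUP_least)
  with sdp ratio show ?thesis by blast
qed

end
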